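(* Let $(X,d)$ be a geodesic metric space. If there exist $\epsilon>0$ and $\rho>0$ such that every $\rho$-bigon in $X$ is $\epsilon$-thin, then $X$ is hyperbolic.
   Context: For $q\ge0$, a $(1,q)$-quasigeodesic is a continuous map $\gamma:[0,L]\to X$ with $|t-t'|-q\le d(\gamma(t),\gamma(t'))\le |t-t'|+q$ for all $t,t'$. A $q$-bigon is a pair of $(1,q)$-quasigeodesics with the same endpoints; their images are its sides. A $q$-bigon is $K$-fat if some point of one side is at distance $\ge K$ from the other side, and $K$-thin otherwise. A geodesic metric space is hyperbolic if there is $\delta\ge0$ such that for every geodesic triangle each side is contained in the $\delta$-neighbourhood of the union of the other two sides. *)

theory Defs
  imports "HOL-Analysis.Analysis"
begin

text \<open>The metric space X is the whole carrier of a type of class metric_space.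
  A path on [0,L] is a function real => 'a whose values outside [0,L] are irrelevant.\<close>

definition quasigeodesic :: "real \<Rightarrow> real \<Rightarrow> (real \<Rightarrow> 'a::metric_space) \<Rightarrow> bool" where
  "quasigeodesic q L \<gamma> \<longleftrightarrow> 0 \<le> L \<and> continuous_on {0..L} \<gamma> \<and>
     (\<forall>t\<in>{0..L}. \<forall>t'\<in>{0..L}.
        \<bar>t - t'\<bar> - q \<le> dist (\<gamma> t) (\<gamma> t') \<and> dist (\<gamma> t) (\<gamma> t') \<le> \<bar>t - t'\<bar> + q)"

definition geodesic :: "real \<Rightarrow> (real \<Rightarrow> 'a::metric_space) \<Rightarrow> bool" where
  "geodesic L \<gamma> \<longleftrightarrow> 0 \<le> L \<and> (\<forall>t\<in>{0..L}. \<forall>t'\<in>{0..L}. dist (\<gamma> t) (\<gamma> t') = \<bar>t - t'\<bar>)"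

definition geodesic_space :: "'a::metric_space itself \<Rightarrow> bool" where
  "geodesic_space TYPE('a) \<longleftrightarrow>
     (\<forall>x y::'a. \<exists>\<gamma>. geodesic (dist x y) \<gamma> \<and> \<gamma> 0 = x \<and> \<gamma> (dist x y) = y)"

definition bigon :: "real \<Rightarrow> real \<Rightarrow> (real \<Rightarrow> 'a::metric_space) \<Rightarrow> real \<Rightarrow> (real \<Rightarrow> 'a) \<Rightarrow> bool" where
  "bigon q L1 \<gamma>1 L2 \<gamma>2 \<longleftrightarrow> quasigeodesic q L1 \<gamma>1 \<and> quasigeodesic q L2 \<gamma>2 \<and>
     \<gamma>1 0 = \<gamma>2 0 \<and> \<gamma>1 L1 = \<gamma>2 L2"

definition bigon_fat :: "real \<Rightarrow> real \<Rightarrow> (real \<Rightarrow> 'a::metric_space) \<Rightarrow> real \<Rightarrow> (real \<Rightarrow> 'a) \<Rightarrow> bool" where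
  "bigon_fat K L1 \<gamma>1 L2 \<gamma>2 \<longleftrightarrow>
     (\<exists>p\<in>\<gamma>1 ` {0..L1}. infdist p (\<gamma>2 ` {0..L2}) \<ge> K) \<or>
     (\<exists>p\<in>\<gamma>2 ` {0..L2}. infdist p (\<gamma>1 ` {0..L1}) \<ge> K)"

definition bigon_thin :: "real \<Rightarrow> real \<Rightarrow> (real \<Rightarrow> 'a::metric_space) \<Rightarrow> real \<Rightarrow> (real \<Rightarrow> 'a) \<Rightarrow> bool" where
  "bigon_thin K L1 \<gamma>1 L2 \<gamma>2 \<longleftrightarrow> \<not> bigon_fat K L1 \<gamma>1 L2 \<gamma>2"

definition hyperbolic :: "'a::metric_space itself \<Rightarrow> bool" where
  "hyperbolic TYPE('a) \<longleftrightarrow> (\<exists>\<delta>\<ge>0. \<forall>L1 L2 L3 (\<gamma>1::real \<Rightarrow> 'a) \<gamma>2 \<gamma>3.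
     geodesic L1 \<gamma>1 \<and> geodesic L2 \<gamma>2 \<and> geodesic L3 \<gamma>3 \<and>
     \<gamma>1 L1 = \<gamma>2 0 \<and> \<gamma>2 L2 = \<gamma>3 0 \<and> \<gamma>3 L3 = \<gamma>1 0 \<longrightarrow>
       (\<forall>p\<in>\<gamma>1 ` {0..L1}. infdist p (\<gamma>2 ` {0..L2} \<union> \<gamma>3 ` {0..L3}) \<le> \<delta>) \<and>
       (\<forall>p\<in>\<gamma>2 ` {0..L2}. infdist p (\<gamma>1 ` {0..L1} \<union> \<gamma>3 ` {0..L3}) \<le> \<delta>) \<and>
       (\<forall>p\<in>\<gamma>3 ` {0..L3}. infdist p (\<gamma>1 ` {0..L1} \<union> \<gamma>2 ` {0..L2}) \<le> \<delta>))"

end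

theory Submission
  imports Defs
begin

text \<open>A \<open>1\<close>-Lipschitz path whose length exceeds the distance of its ends by at most \<open>\<rho>\<close> is a
  \<open>(1,\<rho>)\<close>-quasigeodesic, so any two such paths with common ends are \<open>\<epsilon>\<close>-close. Hence moving the
  endpoint of a geodesic by \<open>\<rho> / 2\<close> moves the geodesic by a bounded amount, and geodesics from a
  common origin with ends at distance \<open>D\<close> stay within a distance linear in \<open>D\<close>. Two geodesics that
  run side by side at bounded distance for long enough must come \<open>\<epsilon>\<close>-close, because otherwise
  crossing from one to the other early and late would give a fat \<open>\<rho>\<close>-bigon. Thus there is a
  universal constant \<open>A\<close> such that geodesics from a common origin with ends at distance \<open>2 * A\<close> are
  within \<open>A\<close> of each other once one goes back by some fixed \<open>T\<close>. Halving along a path repeatedly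
  shows that a geodesic passes within a distance logarithmic in the length of any path joining its
  ends, and this forces geodesic triangles to be thin.\<close>

section \<open>Lipschitz paths and almost geodesic curves\<close>

text \<open>Only the parameter length \<open>l\<close> and the image \<open>Q\<close> stay visible,
  so that paths can be joined and reversed without handling parametrisations. The curve may run
  slower than unit speed, so \<open>l\<close> is just an upper bound for its length.\<close>

definition lip_path :: "real \<Rightarrow> 'a::metric_space \<Rightarrow> 'a \<Rightarrow> 'a set \<Rightarrow> bool" where
  "lip_path l x y Q \<longleftrightarrow> 0 \<le> l \<and>
     (\<exists>c. 1-lipschitz_on {0..l} c \<and> c 0 = x \<and> c l = y \<and> c ` {0..l} = Q)"

lemma image_rev_interval:
  fixes f :: "real \<Rightarrow> 'b"
  shows "(\<lambda>s. f (L - s)) ` {0..L} = f ` {0..L}"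
  using image_image[of f "\<lambda>s. L - s" "{0..L}"] by simp

lemma lip_path_rev:
  assumes "lip_path l x y Q"
  shows "lip_path l y x Q"
proof -
  obtain c where c: "1-lipschitz_on {0..l} c" "c 0 = x" "c l = y" "0 \<le> l" "c ` {0..l} = Q"
    using assms by (auto simp: lip_path_def)
  have "1-lipschitz_on {0..l} (\<lambda>s. c (l - s))"
  proof (rule lipschitz_onI)
    fix s t assume "s \<in> {0..l}" "t \<in> {0..l}"
    then show "dist (c (l - s)) (c (l - t)) \<le> 1 * dist s t"
      using lipschitz_onD[OF c(1), of "l - s" "l - t"] by (auto simp: dist_real_def)
  qed simp
  moreover have "(\<lambda>s. c (l - s)) ` {0..l} = Q"
    using c(5) by (simp only: image_rev_interval)
  ultimately show ?thesis
    using c unfolding lip_path_def by (intro conjI exI[of _ "\<lambda>s. c (l - s)"]) auto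
qed

lemma lip_path_join:
  assumes "lip_path l x y Q" "lip_path l' y z Q'"
  shows "lip_path (l + l') x z (Q \<union> Q')"
proof -
  obtain c where c: "1-lipschitz_on {0..l} c" "c 0 = x" "c l = y" "0 \<le> l" "c ` {0..l} = Q"
    using assms by (auto simp: lip_path_def)
  obtain c' where c': "1-lipschitz_on {0..l'} c'" "c' 0 = y" "c' l' = z" "0 \<le> l'" "c' ` {0..l'} = Q'"
    using assms by (auto simp: lip_path_def)
  define e where "e = (\<lambda>s. if s \<le> l then c s else c' (s - l))"
  have sh: "1-lipschitz_on {l..l+l'} (\<lambda>s. c' (s - l))"
  proof (rule lipschitz_onI)
    fix s t assume "s \<in> {l..l+l'}" "t \<in> {l..l+l'}"
    then show "dist (c' (s - l)) (c' (t - l)) \<le> 1 * dist s t"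
      using lipschitz_onD[OF c'(1), of "s - l" "t - l"] by (auto simp: dist_real_def)
  qed simp
  have "1-lipschitz_on {0..l+l'} e"
    unfolding e_def by (rule lipschitz_on_concat[OF c(1) sh]) (use c c' in auto)
  moreover have "e ` {0..l+l'} = Q \<union> Q'"
  proof (intro equalityI subsetI)
    fix w assume "w \<in> e ` {0..l+l'}"
    then obtain s where s: "s \<in> {0..l+l'}" "w = e s" by blast
    show "w \<in> Q \<union> Q'"
    proof (cases "s \<le> l")
      case True
      then show ?thesis using s c(5) by (auto simp: e_def)
    next
      case False
      then have "s - l \<in> {0..l'}" using s by auto
      then show ?thesis using s c'(5) False by (auto simp: e_def)
    qed
  next
    fix w assume "w \<in> Q \<union> Q'"
    then show "w \<in> e ` {0..l+l'}"
    proof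
      assume "w \<in> Q"
      then obtain s where "s \<in> {0..l}" "w = c s" using c(5) by blast
      then show ?thesis using c'(4) by (intro image_eqI[of _ _ s]) (auto simp: e_def)
    next
      assume "w \<in> Q'"
      then obtain s where s: "s \<in> {0..l'}" "w = c' s" using c'(5) by blast
      \<comment> \<open>At \<open>s = 0\<close> the glued path still uses its first branch, so
        \<open>c l = y = c' 0\<close> is needed there.\<close>
      have "w = e (l + s)"
        using s c(3) c'(2) by (cases "s = 0") (auto simp: e_def)
      then show ?thesis using s c(4) by (intro image_eqI[of _ _ "l + s"]) auto
    qed
  qed
  ultimately show ?thesis
    using c c' unfolding lip_path_def
    by (intro conjI exI[of _ e]) (auto simp: e_def)
qed

text \<open>For \<open>s \<le> t\<close> the pieces of \<open>c\<close> before \<open>s\<close> and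
  after \<open>t\<close> account for at most \<open>s + (l - t)\<close> of the distance between the
  ends, which leaves at least \<open>(t - s) - q\<close> for \<open>c s\<close> and
  \<open>c t\<close>.\<close>

lemma lip_path_quasigeodesic:
  assumes c: "1-lipschitz_on {0..l} c" and "0 \<le> l" and l: "l \<le> dist (c 0) (c l) + q"
  shows "quasigeodesic q l c"
proof -
  have D: "dist (c s) (c t) \<le> \<bar>s - t\<bar>" if "s \<in> {0..l}" "t \<in> {0..l}" for s t
    using lipschitz_onD[OF c that] by (simp add: dist_real_def)
  have "q \<ge> 0" using D[of 0 l] assms by auto
  have E: "\<bar>s - t\<bar> - q \<le> dist (c s) (c t)" if "s \<in> {0..l}" "t \<in> {0..l}" "s \<le> t" for s t
    using D[of 0 s] D[of t l] that l dist_triangle[of "c 0" "c l" "c s"]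
      dist_triangle[of "c s" "c l" "c t"] by auto
  have E': "\<bar>s - t\<bar> - q \<le> dist (c s) (c t)" if "s \<in> {0..l}" "t \<in> {0..l}" for s t
    using E[of s t] E[of t s] that by (cases "s \<le> t") (auto simp: dist_commute abs_minus_commute)
  show ?thesis unfolding quasigeodesic_def
    using E' D \<open>q \<ge> 0\<close> \<open>0 \<le> l\<close> lipschitz_on_continuous_on[OF c] by fastforce
qed

section \<open>Restriction and reversal of geodesics\<close>

lemma geodesic_dist:
  assumes "geodesic L f" "0 \<le> s" "s \<le> L" "0 \<le> t" "t \<le> L"
  shows "dist (f s) (f t) = \<bar>s - t\<bar>"
  using assms by (auto simp: geodesic_def)

lemma geodesic_prefix:
  assumes "geodesic L f" "0 \<le> v" "v \<le> L"
  shows "geodesic v f"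
  using assms by (auto simp: geodesic_def)

lemma geodesic_segment:
  assumes "geodesic L f" "0 \<le> a" "a \<le> b" "b \<le> L"
  shows "geodesic (b - a) (\<lambda>s. f (a + s))"
  using assms by (auto simp: geodesic_def)

lemma geodesic_rev:
  assumes "geodesic L f"
  shows "geodesic L (\<lambda>s. f (L - s))"
  using assms by (auto simp: geodesic_def)

lemma geodesic_lipschitz:
  assumes "geodesic L f"
  shows "1-lipschitz_on {0..L} f"
  using assms by (intro lipschitz_onI) (auto simp: geodesic_def dist_real_def)

lemma geodesic_lip_path:
  assumes "geodesic L f"
  shows "lip_path L (f 0) (f L) (f ` {0..L})"
  using assms geodesic_lipschitz[OF assms] by (auto simp: geodesic_def lip_path_def)

lemma geodesic_segment_lip_path:
  assumes "geodesic L f" "0 \<le> a" "a \<le> b" "b \<le> L"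
  shows "lip_path (b - a) (f a) (f b) (f ` {a..b})"
proof -
  have "(\<lambda>s. f (a + s)) ` {0..b - a} = f ` ((+) a ` {0..b - a})" by (simp only: image_image)
  then show ?thesis
    using geodesic_lip_path[OF geodesic_segment[OF assms]] by simp
qed

section \<open>Dyadic logarithm against linear growth\<close>

text \<open>The least \<open>k\<close> with \<open>x \<le> 2 ^ k\<close> satisfies
  \<open>2 ^ k < 2 * x\<close> once it is positive, and \<open>k / 2 ^ k\<close> tends to 0. Later
  \<open>k\<close> counts halvings of a path and \<open>T\<close> is the cost of each, so the total
  cost has arbitrarily small linear slope.\<close>

lemma linear_dominates_dyadic_log:
  fixes T \<eta> :: real
  assumes "\<eta> > 0" "T \<ge> 0"
  shows "\<exists>C\<ge>0. \<forall>x\<ge>0. \<exists>k::nat. x \<le> 2 ^ k \<and> T * k \<le> \<eta> * x + C"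
proof -
  have "(\<lambda>k. real k / 2 ^ k) \<longlonglongrightarrow> 0"
    using LIMSEQ_divide_realpow_zero powser_times_n_limit_0[of "1/2::real"]
    by (simp add: power_divide)
  then have "\<forall>\<^sub>F k in sequentially. real k / 2 ^ k < \<eta> / (2 * T + 1)"
    by (rule order_tendstoD) (use assms in auto)
  then obtain N where N: "\<And>k. k \<ge> N \<Longrightarrow> real k / 2 ^ k < \<eta> / (2 * T + 1)"
    by (auto simp: eventually_sequentially)
  have B: "T * k \<le> \<eta> / 2 * 2 ^ k" if "k \<ge> N" for k
  proof -
    have "real k * (2 * T + 1) < \<eta> * 2 ^ k"
      using N[OF that] assms by (simp add: field_simps)
    then show ?thesis by (simp add: algebra_simps)
  qed
  show ?thesis
  proof (intro exI[of _ "T * (N + 1)"] conjI allI impI)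
    show "0 \<le> T * (N + 1)" using assms by simp
    fix x :: real assume "x \<ge> 0"
    obtain k0 where k0: "x \<le> 2 ^ k0" 
      using real_arch_pow[of 2 x] by (auto intro: less_imp_le)
    define k where "k = (LEAST k. x \<le> 2 ^ k)"
    have k: "x \<le> 2 ^ k" unfolding k_def by (rule LeastI[of _ k0]) fact
    have "T * k \<le> \<eta> * x + T * (N + 1)"
    proof (cases "k \<le> N + 1")
      case True
      then have "T * k \<le> T * (N + 1)" using assms by (intro mult_left_mono) auto
      then show ?thesis using \<open>x \<ge> 0\<close> assms by (simp add: add_increasing)
    next
      case False
      then have "\<not> x \<le> 2 ^ (k - 1)" unfolding k_def by (intro not_less_Least) auto
      moreover have "(2::real) ^ k = 2 * 2 ^ (k - 1)" using False by (cases k) auto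
      ultimately have "2 ^ k \<le> 2 * x" by simp
      then have "\<eta> / 2 * 2 ^ k \<le> \<eta> / 2 * (2 * x)" using assms by (intro mult_left_mono) auto
      moreover have "0 \<le> T * (N + 1)" using assms by simp
      ultimately show ?thesis using B[of k] False by simp
    qed
    then show "\<exists>k::nat. x \<le> 2 ^ k \<and> T * k \<le> \<eta> * x + T * (N + 1)" using k by blast
  qed
qed

section \<open>Thin bigons and fellow travelling\<close>

locale thin_bigon_space =
  fixes X :: "'a::metric_space itself" and \<epsilon> \<rho> :: real
  assumes geodesic_space: "geodesic_space TYPE('a)"
    and eps_pos: "\<epsilon> > 0" and rho_pos: "\<rho> > 0"
    and thin: "\<And>L1 (\<gamma>1::real \<Rightarrow> 'a) L2 \<gamma>2. bigon \<rho> L1 \<gamma>1 L2 \<gamma>2 \<Longrightarrow> bigon_thin \<epsilon> L1 \<gamma>1 L2 \<gamma>2"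
begin

lemma geodesic_between:
  fixes x y :: 'a
  obtains f where "geodesic (dist x y) f" "f 0 = x" "f (dist x y) = y"
  using geodesic_space by (auto simp: geodesic_space_def)

text \<open>Both paths are \<rho>-quasigeodesics, so they form a \<rho>-bigon. Thinness is a strict
  bound on the infimal distance, hence some point of \<open>Q'\<close> realises it.\<close>

lemma near_geodesics_close:
  fixes x y :: 'a
  assumes "lip_path l x y Q" "lip_path l' x y Q'"
    and "l \<le> dist x y + \<rho>" "l' \<le> dist x y + \<rho>" and "a \<in> Q"
  obtains b where "b \<in> Q'" "dist a b < \<epsilon>"
proof -
  obtain c where c: "1-lipschitz_on {0..l} c" "c 0 = x" "c l = y" "0 \<le> l" "c ` {0..l} = Q"
    using assms by (auto simp: lip_path_def)
  obtain c' where c': "1-lipschitz_on {0..l'} c'" "c' 0 = x" "c' l' = y" "0 \<le> l'" "c' ` {0..l'} = Q'"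
    using assms by (auto simp: lip_path_def)
  have "bigon \<rho> l c l' c'"
    unfolding bigon_def using c c' assms by (auto intro!: lip_path_quasigeodesic)
  then have "bigon_thin \<epsilon> l c l' c'" by (rule thin)
  then have "infdist a Q' < \<epsilon>"
    using \<open>a \<in> Q\<close> unfolding bigon_thin_def bigon_fat_def c(5) c'(5) by (meson not_le)
  moreover have ne: "Q' \<noteq> {}" using c'(4,5) by auto
  ultimately have "\<not> (\<forall>b\<in>Q'. \<epsilon> \<le> dist a b)"
    unfolding infdist_notempty[OF ne] using cINF_greatest[OF ne, of \<epsilon> "dist a"] by (meson not_le)
  then show thesis using that by (meson not_le)
qed

text \<open>Extend \<open>g\<close> by a geodesic \<open>h\<close> from \<open>g L'\<close> to
  \<open>f L\<close>. The gap between the ends enters the excess length twice, once as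
  \<open>h\<close> and once in comparing \<open>L'\<close> with \<open>L\<close>, so a gap of
  \<open>\<rho> / 2\<close> is affordable. Points of \<open>h\<close> are replaced by
  \<open>g L'\<close>.\<close>

lemma geodesic_point_close:
  fixes f g :: "real \<Rightarrow> 'a"
  assumes f: "geodesic L f" and g: "geodesic L' g" and "f 0 = g 0"
    and D: "dist (f L) (g L') \<le> \<rho> / 2" and t: "0 \<le> t" "t \<le> L"
  obtains s where "0 \<le> s" "s \<le> L'" "dist (f t) (g s) \<le> \<epsilon> + \<rho> / 2"
proof -
  let ?d = "dist (g L') (f L)"
  obtain h where h: "geodesic ?d h" "h 0 = g L'" "h ?d = f L" by (rule geodesic_between)
  have LL: "0 \<le> L" "0 \<le> L'" using f g by (auto simp: geodesic_def)
  have L: "dist (f 0) (f L) = L" "dist (g 0) (g L') = L'"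
    using geodesic_dist[OF f, of 0 L] geodesic_dist[OF g, of 0 L'] LL by auto
  have 1: "lip_path L (f 0) (f L) (f ` {0..L})" by (rule geodesic_lip_path[OF f])
  have 2: "lip_path (L' + ?d) (f 0) (f L) (g ` {0..L'} \<union> h ` {0..?d})"
    using lip_path_join[OF geodesic_lip_path[OF g], of ?d "f L"] geodesic_lip_path[OF h(1)] h assms(3)
    by simp
  have "L' + ?d \<le> dist (f 0) (f L) + \<rho>"
    using L D dist_triangle[of "g 0" "g L'" "f L"] assms(3) by (simp add: dist_commute)
  then obtain b where b: "b \<in> g ` {0..L'} \<union> h ` {0..?d}" "dist (f t) b < \<epsilon>"
    using near_geodesics_close[OF 1 2] L t rho_pos by (metis add_increasing2 atLeastAtMost_iff imageI less_eq_real_def)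
  from b(1) show thesis
  proof
    assume "b \<in> g ` {0..L'}"
    then show thesis using b(2) rho_pos by (auto intro: that)
  next
    assume "b \<in> h ` {0..?d}"
    then obtain s where s: "0 \<le> s" "s \<le> ?d" "b = h s" by auto
    then have "dist (g L') b \<le> \<rho> / 2"
      using geodesic_dist[OF h(1), of 0 s] h(2) D by (simp add: dist_commute)
    then show thesis
      using b(2) LL dist_triangle[of "f t" "g L'" b] by (intro that[of L']) (auto simp: dist_commute)
  qed
qed

text \<open>Close points have almost equal distances to the common origin, so the nearby point
  \<open>g s\<close> can be traded for the one with the same parameter. Clamping by
  \<open>min\<close> lets one \<open>t\<close> serve two lengths.\<close>

lemma fellow_travel_step:
  fixes f g :: "real \<Rightarrow> 'a"
  assumes f: "geodesic L f" and g: "geodesic L' g" and "f 0 = g 0"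
    and D: "dist (f L) (g L') \<le> \<rho> / 2" and "0 \<le> t"
  shows "dist (f (min t L)) (g (min t L')) \<le> 2 * \<epsilon> + 2 * \<rho>"
proof -
  have LL: "0 \<le> L" "0 \<le> L'" using f g by (auto simp: geodesic_def)
  let ?t = "min t L"
  have "0 \<le> ?t" "?t \<le> L" using LL \<open>0 \<le> t\<close> by auto
  then obtain s where s: "0 \<le> s" "s \<le> L'" "dist (f ?t) (g s) \<le> \<epsilon> + \<rho> / 2"
    using geodesic_point_close[OF f g assms(3) D] by metis
  have d: "dist (f 0) (f ?t) = ?t" "dist (g 0) (g s) = s" "dist (f 0) (f L) = L" "dist (g 0) (g L') = L'"
    using geodesic_dist[OF f] geodesic_dist[OF g] LL \<open>0 \<le> t\<close> s by auto
  have 1: "\<bar>?t - s\<bar> \<le> \<epsilon> + \<rho> / 2"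
    using d s(3) assms(3) abs_dist_diff_le[of "f ?t" "f 0" "g s"] by (simp add: dist_commute)
  have 2: "\<bar>L - L'\<bar> \<le> \<rho> / 2"
    using d D assms(3) abs_dist_diff_le[of "f L" "f 0" "g L'"] by (simp add: dist_commute)
  have "\<bar>s - min t L'\<bar> \<le> \<epsilon> + \<rho>"
    using 1 2 s(2) rho_pos eps_pos by linarith
  moreover have "dist (g s) (g (min t L')) = \<bar>s - min t L'\<bar>"
    using geodesic_dist[OF g] s LL \<open>0 \<le> t\<close> by auto
  ultimately show ?thesis
    using s(3) dist_triangle[of "f ?t" "g (min t L')" "g s"] rho_pos by linarith
qed

text \<open>Divide a geodesic between the two ends into pieces of length at most
  \<open>\<rho> / 2\<close>, draw geodesics from the origin to the division points, and add up the
  single steps.\<close>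

lemma fellow_travel_linear:
  fixes f g :: "real \<Rightarrow> 'a"
  assumes "geodesic L f" "geodesic L' g" "f 0 = g 0"
    and "dist (f L) (g L') \<le> n * (\<rho> / 2)" "0 \<le> t"
  shows "dist (f (min t L)) (g (min t L')) \<le> (real n + 1) * (2 * \<epsilon> + 2 * \<rho>)"
  using assms
proof (induction n arbitrary: L f)
  case 0
  then have "dist (f L) (g L') \<le> \<rho> / 2" using rho_pos by simp
  then show ?case using fellow_travel_step[OF 0(1-3)] 0 by simp
next
  case (Suc n)
  let ?d = "dist (f L) (g L')"
  obtain h where h: "geodesic ?d h" "h 0 = f L" "h ?d = g L'" by (rule geodesic_between)
  define s where "s = min (\<rho> / 2) ?d"
  have s: "0 \<le> s" "s \<le> ?d" "s \<le> \<rho> / 2" "?d - s \<le> n * (\<rho> / 2)"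
    using Suc.prems(4) rho_pos by (auto simp: s_def min_def algebra_simps)
  have w: "dist (f L) (h s) \<le> \<rho> / 2" "dist (h s) (g L') \<le> n * (\<rho> / 2)"
    using geodesic_dist[OF h(1), of 0 s] geodesic_dist[OF h(1), of s ?d] h s by auto
  let ?e = "dist (f 0) (h s)"
  obtain k where k: "geodesic ?e k" "k 0 = f 0" "k ?e = h s" by (rule geodesic_between)
  have 1: "dist (f (min t L)) (k (min t ?e)) \<le> 2 * \<epsilon> + 2 * \<rho>"
    by (rule fellow_travel_step) (use Suc.prems k w in auto)
  have 2: "dist (k (min t ?e)) (g (min t L')) \<le> (real n + 1) * (2 * \<epsilon> + 2 * \<rho>)"
    by (rule Suc.IH) (use Suc.prems k w in auto)
  show ?case
    using 1 2 dist_triangle[of "f (min t L)" "g (min t L')" "k (min t ?e)"]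
    by (simp add: algebra_simps)
qed

lemma fellow_travel:
  "\<exists>K\<ge>0. \<forall>L L' (f::real \<Rightarrow> 'a) g t. geodesic L f \<longrightarrow> geodesic L' g \<longrightarrow> f 0 = g 0 \<longrightarrow>
     dist (f L) (g L') \<le> D \<longrightarrow> 0 \<le> t \<longrightarrow> dist (f (min t L)) (g (min t L')) \<le> K"
proof -
  obtain n :: nat where n: "D / (\<rho> / 2) \<le> n" using real_arch_simple by blast
  then have "D \<le> n * (\<rho> / 2)" using rho_pos by (simp add: field_simps)
  then show ?thesis
    using fellow_travel_linear[where n = n] eps_pos rho_pos
    by (intro exI[of _ "(real n + 1) * (2 * \<epsilon> + 2 * \<rho>)"]) (auto intro: order_trans)
qed

section \<open>Contraction of geodesics from a common origin\<close>

text \<open>The cost \<open>dist (f a) (g b) - (b - a)\<close> of crossing from \<open>f\<close> to \<open>g\<close> lies between \<open>- K\<close> and \<open>K\<close>.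
  If crossing within the first or within the last third of \<open>{a..b}\<close> costs at most \<open>\<rho>\<close> more than
  crossing within \<open>{a..b}\<close>, the early and the late crossing form a \<open>\<rho>\<close>-bigon; otherwise pass to a
  third with a cost that is larger by \<open>\<rho>\<close>, which can only happen boundedly often.\<close>

lemma ribbon_pinch:
  fixes f g :: "real \<Rightarrow> 'a"
  assumes f: "geodesic L f" and g: "geodesic L g"
    and K: "\<And>t. 0 \<le> t \<Longrightarrow> t \<le> L \<Longrightarrow> dist (f t) (g t) \<le> K"
    and ab: "0 \<le> a" "b \<le> L" "4 * (K + \<epsilon>) * 3 ^ n \<le> b - a"
    and cost: "dist (f a) (g b) - (b - a) > K - n * \<rho>"
  shows "\<exists>v\<in>{a..b}. \<exists>w\<in>{a..b}. dist (f v) (g w) \<le> \<epsilon>"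
  using ab cost
proof (induction n arbitrary: a b)
  case 0
  have "0 \<le> L" using f by (simp add: geodesic_def)
  then have "0 \<le> K" using K[of 0] zero_le_dist order_trans by blast
  then have le: "a \<le> b" using 0 eps_pos by (auto intro: order_trans[of 0 "4 * (K + \<epsilon>)"])
  \<comment> \<open>For \<open>n = 0\<close> the cost is assumed to exceed \<open>K\<close>, which
    this triangle inequality forbids.\<close>
  have "dist (f a) (g b) \<le> dist (f a) (f b) + dist (f b) (g b)" by (rule dist_triangle)
  also have "\<dots> \<le> (b - a) + K"
    using geodesic_dist[OF f, of a b] K[of b] 0 le by auto
  finally show ?case using 0 by simp
next
  case (Suc n)
  have "0 \<le> L" using f by (simp add: geodesic_def)
  then have K0: "0 \<le> K" using K[of 0] zero_le_dist order_trans by blast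
  define r where "r = (b - a) / 3"
  have r: "4 * (K + \<epsilon>) * 3 ^ n \<le> r" using Suc.prems(3) by (simp add: r_def)
  have "4 * (K + \<epsilon>) * 1 \<le> 4 * (K + \<epsilon>) * 3 ^ n"
    using K0 eps_pos by (intro mult_left_mono) auto
  then have r4: "4 * K + 4 * \<epsilon> \<le> r" using r by simp
  have r0: "r > 0" using r4 K0 eps_pos by linarith
  define a1 a2 where "a1 = a + r" and "a2 = b - r"
  have ord: "a < a1" "a1 < a2" "a2 < b" "a2 - a1 = r" "a1 - a = r" "b - a2 = r"
    using r0 by (auto simp: a1_def a2_def r_def field_simps)
  have sub: ?case if "a \<le> a'" "b' \<le> b" "b' - a' = r"
    and "dist (f a') (g b') - (b' - a') > dist (f a) (g b) - (b - a) + \<rho>" for a' b'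
  proof -
    have "\<exists>v\<in>{a'..b'}. \<exists>w\<in>{a'..b'}. dist (f v) (g w) \<le> \<epsilon>"
      by (rule Suc.IH) (use that Suc.prems r in \<open>auto simp: algebra_simps\<close>)
    then show ?thesis using that by fastforce
  qed
  show ?case
  proof (cases "dist (f a) (g a1) - (a1 - a) \<le> dist (f a) (g b) - (b - a) + \<rho> \<and>
      dist (f a2) (g b) - (b - a2) \<le> dist (f a) (g b) - (b - a) + \<rho>")
    case False
    then show ?thesis using sub[of a a1] sub[of a2 b] ord by force
  next
    case True
    let ?d1 = "dist (f a) (g a1)" and ?d2 = "dist (f a2) (g b)"
    obtain h1 where h1: "geodesic ?d1 h1" "h1 0 = f a" "h1 ?d1 = g a1" by (rule geodesic_between)
    obtain h2 where h2: "geodesic ?d2 h2" "h2 0 = f a2" "h2 ?d2 = g b" by (rule geodesic_between)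
    have p1: "lip_path (?d1 + (b - a1)) (f a) (g b) (h1 ` {0..?d1} \<union> g ` {a1..b})"
      using lip_path_join[OF geodesic_lip_path[OF h1(1)], of "b - a1" "g b" "g ` {a1..b}"]
        geodesic_segment_lip_path[OF g, of a1 b] h1 ord Suc.prems by simp
    have p2: "lip_path ((a2 - a) + ?d2) (f a) (g b) (f ` {a..a2} \<union> h2 ` {0..?d2})"
      using lip_path_join[OF geodesic_segment_lip_path[OF f, of a a2], of ?d2 "g b"]
        geodesic_lip_path[OF h2(1)] h2 ord Suc.prems by simp
    \<comment> \<open>The late crossing \<open>p2\<close> leaves \<open>f\<close> only at
      \<open>f a2\<close>. A point of the early crossing \<open>p1\<close> near \<open>f a2\<close>
      lies on \<open>g\<close>, as desired, or on \<open>h1\<close>; the latter stays within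
      \<open>r + K\<close> of \<open>f a\<close>, too far from \<open>f a2\<close> at distance
      \<open>2 * r\<close>.\<close>
    obtain z where z: "z \<in> h1 ` {0..?d1} \<union> g ` {a1..b}" "dist (f a2) z < \<epsilon>"
      by (rule near_geodesics_close[OF p2 p1, of "f a2"]) (use True ord in auto)
    from z(1) show ?thesis
    proof
      assume "z \<in> g ` {a1..b}"
      then obtain w where "w \<in> {a1..b}" "z = g w" by blast
      then show ?thesis using z(2) ord by (intro bexI[of _ a2] bexI[of _ w]) auto
    next
      assume "z \<in> h1 ` {0..?d1}"
      then obtain s where s: "0 \<le> s" "s \<le> ?d1" "z = h1 s" by auto
      have "dist (f a) z \<le> ?d1" using geodesic_dist[OF h1(1), of 0 s] s h1 by auto
      also have "?d1 \<le> dist (f a) (f a1) + dist (f a1) (g a1)" by (rule dist_triangle)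
      also have "\<dots> \<le> r + K"
        using geodesic_dist[OF f, of a a1] K[of a1] ord Suc.prems by auto
      finally have "dist (f a) z \<le> r + K" .
      moreover have "dist (f a) (f a2) = 2 * r"
        using geodesic_dist[OF f, of a a2] ord Suc.prems by auto
      ultimately have "2 * r \<le> r + K + \<epsilon>"
        using z(2) dist_triangle[of "f a" "f a2" z] by (simp add: dist_commute)
      then show ?thesis using r4 K0 eps_pos by linarith
    qed
  qed
qed

text \<open>The bound \<open>A\<close> does not depend on \<open>D\<close>; only the waiting time
  \<open>T\<close> does. The geodesics stay \<open>K\<close>-close with \<open>K\<close> depending
  on \<open>D\<close>, a long ribbon of that width pinches to width \<epsilon>, and before the pinch
  the fellow-travel constant for \<epsilon> applies.\<close>

lemma contraction:
  "\<exists>A>0. \<forall>D. \<exists>T\<ge>0. \<forall>L L' (f::real \<Rightarrow> 'a) g t. geodesic L f \<longrightarrow> geodesic L' g \<longrightarrow> f 0 = g 0 \<longrightarrow>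
     dist (f L) (g L') \<le> D \<longrightarrow> 0 \<le> t \<longrightarrow> t + T \<le> L \<longrightarrow> dist (f t) (g t) \<le> A"
proof -
  obtain A where A: "A \<ge> 0" "\<And>L L' (f::real \<Rightarrow> 'a) g t. \<lbrakk>geodesic L f; geodesic L' g; f 0 = g 0;
     dist (f L) (g L') \<le> \<epsilon>; 0 \<le> t\<rbrakk> \<Longrightarrow> dist (f (min t L)) (g (min t L')) \<le> A"
    using fellow_travel[of \<epsilon>] by blast
  show ?thesis
  proof (rule exI[of _ "A + 1"], intro conjI allI)
    show "A + 1 > 0" using A by simp
    fix D :: real
    obtain K where K: "K \<ge> 0" "\<And>L L' (f::real \<Rightarrow> 'a) g t. \<lbrakk>geodesic L f; geodesic L' g; f 0 = g 0;
      dist (f L) (g L') \<le> D; 0 \<le> t\<rbrakk> \<Longrightarrow> dist (f (min t L)) (g (min t L')) \<le> K"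
      using fellow_travel[of D] by blast
    \<comment> \<open>Crossing costs are at least \<open>- K\<close>, so this \<open>n\<close> meets
      the cost hypothesis of \<open>ribbon_pinch\<close>.\<close>
    obtain n :: nat where "2 * K / \<rho> < n" using reals_Archimedean2 by blast
    then have n: "K - n * \<rho> < - K" using rho_pos by (simp add: field_simps)
    define M where "M = 4 * (K + \<epsilon>) * 3 ^ n"
    have M: "0 \<le> M" using K eps_pos by (simp add: M_def)
    show "\<exists>T\<ge>0. \<forall>L L' (f::real \<Rightarrow> 'a) g t. geodesic L f \<longrightarrow> geodesic L' g \<longrightarrow> f 0 = g 0 \<longrightarrow>
       dist (f L) (g L') \<le> D \<longrightarrow> 0 \<le> t \<longrightarrow> t + T \<le> L \<longrightarrow> dist (f t) (g t) \<le> A + 1"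
    \<comment> \<open>\<open>M\<close> is the ribbon length needed for a pinch;
      \<open>\<bar>D\<bar>\<close> compensates for \<open>L'\<close> being shorter than
      \<open>L\<close>.\<close>
    proof (intro exI[of _ "M + \<bar>D\<bar>"] conjI allI impI)
      show "0 \<le> M + \<bar>D\<bar>" using M by simp
      fix L L' t and f g :: "real \<Rightarrow> 'a"
      assume f: "geodesic L f" and g: "geodesic L' g" and 0: "f 0 = g 0"
        and D: "dist (f L) (g L') \<le> D" and t: "0 \<le> t" "t + (M + \<bar>D\<bar>) \<le> L"
      have LL: "0 \<le> L" "0 \<le> L'" using f g by (auto simp: geodesic_def)
      have d: "dist (f 0) (f L) = L" "dist (g 0) (g L') = L'"
        using geodesic_dist[OF f, of 0 L] geodesic_dist[OF g, of 0 L'] LL by auto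
      define R where "R = min L L'"
      have R: "R \<le> L" "R \<le> L'" "t + M \<le> R"
        using d D 0 t dist_triangle[of "g 0" "f L" "g L'"] by (auto simp: R_def dist_commute)
      have R0: "0 \<le> R" using R M t by linarith
      have fR: "geodesic R f" and gR: "geodesic R g"
        using geodesic_prefix[OF f] geodesic_prefix[OF g] R R0 by auto
      have KR: "dist (f s) (g s) \<le> K" if "0 \<le> s" "s \<le> R" for s
        using K(2)[OF f g 0 D, of s] that R by (simp add: min_absorb1)
      have c: "- K \<le> dist (f (R - M)) (g R) - M"
        using geodesic_dist[OF fR, of "R - M" R] KR[of R] R R0 M t
          dist_triangle[of "f (R - M)" "f R" "g R"] by (simp add: dist_commute)
      obtain v w where vw: "v \<in> {R - M..R}" "w \<in> {R - M..R}" "dist (f v) (g w) \<le> \<epsilon>"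
        using ribbon_pinch[OF fR gR KR, of "R - M" R n] R R0 M t n c unfolding M_def by force
      have "geodesic v f" "geodesic w g"
        using geodesic_prefix[OF fR, of v] geodesic_prefix[OF gR, of w] vw R t by auto
      from A(2)[OF this 0 vw(3) t(1)] show "dist (f t) (g t) \<le> A + 1"
        using vw(1,2) R by (simp add: min_absorb1)
    qed
  qed
qed

section \<open>Geodesics and long paths\<close>

text \<open>Halve the path and draw the geodesic \<open>h\<close> to its midpoint. By induction
  \<open>f\<close>, \<open>h\<close> and \<open>h\<close>, \<open>g\<close> are
  \<open>A\<close>-close at \<open>t + T\<close>, so \<open>f\<close> and \<open>g\<close> are
  \<open>2 * A\<close>-close there, and going back by \<open>T\<close> restores \<open>A\<close>.
  Each halving thus costs one \<open>T\<close>.\<close>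

lemma dyadic_contraction:
  fixes f g c :: "real \<Rightarrow> 'a"
  assumes step: "\<And>L L' (f::real \<Rightarrow> 'a) g t. \<lbrakk>geodesic L f; geodesic L' g; f 0 = g 0;
      dist (f L) (g L') \<le> 2 * A; 0 \<le> t; t + T \<le> L\<rbrakk> \<Longrightarrow> dist (f t) (g t) \<le> A"
    and "T \<ge> 0"
    and "geodesic L f" "geodesic L' g" "f 0 = g 0" "f L = c a" "g L' = c b"
    and "1-lipschitz_on {a..b} c" "a \<le> b" "b - a \<le> 2 * A * 2 ^ k" "0 \<le> t"
    and "\<And>s. s \<in> {a..b} \<Longrightarrow> t + T * (k + 1) \<le> dist (f 0) (c s)"
  shows "dist (f t) (g t) \<le> A"
  using assms(3-)
proof (induction k arbitrary: L L' f g a b t)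
  case 0
  have "dist (f L) (g L') \<le> 2 * A"
    using lipschitz_onD[OF 0(6), of a b] 0 by (simp add: dist_real_def)
  moreover have "dist (f 0) (f L) = L"
    using geodesic_dist[OF 0(1), of 0 L] 0(1) by (simp add: geodesic_def)
  then have "t + T \<le> L" using 0(10)[of a] 0 by simp
  ultimately show ?case using step 0 by blast
next
  case (Suc k)
  define m where "m = (a + b) / 2"
  have m: "a \<le> m" "m \<le> b" "m - a \<le> 2 * A * 2 ^ k" "b - m \<le> 2 * A * 2 ^ k"
    using Suc.prems by (auto simp: m_def field_simps)
  let ?e = "dist (f 0) (c m)"
  obtain h where h: "geodesic ?e h" "h 0 = f 0" "h ?e = c m" by (rule geodesic_between)
  have far: "t + T + T * (k + 1) \<le> dist (f 0) (c s)" if "s \<in> {a..b}" for s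
    using Suc.prems(10)[OF that] by (simp add: algebra_simps)
  have 1: "dist (f (t + T)) (h (t + T)) \<le> A"
    by (rule Suc.IH[OF Suc.prems(1) h(1), of a m])
      (use Suc.prems h m far \<open>T \<ge> 0\<close> in \<open>auto intro: lipschitz_on_subset\<close>)
  have 2: "dist (h (t + T)) (g (t + T)) \<le> A"
    by (rule Suc.IH[OF h(1) Suc.prems(2), of m b])
      (use Suc.prems h m far \<open>T \<ge> 0\<close> in \<open>auto intro: lipschitz_on_subset\<close>)
  have d: "dist (f (t + T)) (g (t + T)) \<le> 2 * A"
    using 1 2 dist_triangle[of "f (t + T)" "g (t + T)" "h (t + T)"] by simp
  have "dist (f 0) (f L) = L" "dist (g 0) (g L') = L'" 
    using geodesic_dist[OF Suc.prems(1), of 0 L] geodesic_dist[OF Suc.prems(2), of 0 L'] Suc.prems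
    by (auto simp: geodesic_def)
  moreover have "0 \<le> T * (k + 1)" using \<open>T \<ge> 0\<close> by simp
  ultimately have "t + T \<le> L" "t + T \<le> L'"
    using far[of a] far[of b] Suc.prems by auto
  then have "geodesic (t + T) f" "geodesic (t + T) g"
    using geodesic_prefix[OF Suc.prems(1)] geodesic_prefix[OF Suc.prems(2)] Suc.prems(9) \<open>T \<ge> 0\<close> by auto
  then show ?case
    by (rule step) (use d Suc.prems in auto)
qed

lemma contraction_along_path:
  "\<exists>A>0. \<forall>\<eta>>0. \<exists>C\<ge>0. \<forall>L L' l (f::real \<Rightarrow> 'a) g c t.
     geodesic L f \<longrightarrow> geodesic L' g \<longrightarrow> f 0 = g 0 \<longrightarrow> f L = c 0 \<longrightarrow> g L' = c l \<longrightarrow>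
     1-lipschitz_on {0..l} c \<longrightarrow> 0 \<le> l \<longrightarrow> 0 \<le> t \<longrightarrow>
     (\<forall>s\<in>{0..l}. t + \<eta> * l + C \<le> dist (f 0) (c s)) \<longrightarrow> dist (f t) (g t) \<le> A"
proof -
  obtain A where A: "A > 0" "\<forall>D. \<exists>T\<ge>0. \<forall>L L' (f::real \<Rightarrow> 'a) g t. geodesic L f \<longrightarrow> geodesic L' g \<longrightarrow>
      f 0 = g 0 \<longrightarrow> dist (f L) (g L') \<le> D \<longrightarrow> 0 \<le> t \<longrightarrow> t + T \<le> L \<longrightarrow> dist (f t) (g t) \<le> A"
    using contraction by blast
  obtain T where T: "T \<ge> 0" "\<And>L L' (f::real \<Rightarrow> 'a) g t. \<lbrakk>geodesic L f; geodesic L' g; f 0 = g 0;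
      dist (f L) (g L') \<le> 2 * A; 0 \<le> t; t + T \<le> L\<rbrakk> \<Longrightarrow> dist (f t) (g t) \<le> A"
    using A(2)[rule_format, of "2 * A"] by blast
  show ?thesis
  proof (rule exI[of _ A], intro conjI allI impI)
    show "A > 0" by fact
    fix \<eta> :: real assume "\<eta> > 0"
    \<comment> \<open>Halving stops at length \<open>2 * A\<close>, so the count is applied to
      \<open>l / (2 * A)\<close>; the slope is rescaled to leave \<open>\<eta> * l\<close>.\<close>
    obtain C where C: "C \<ge> 0" "\<And>x. x \<ge> 0 \<Longrightarrow> \<exists>k::nat. x \<le> 2 ^ k \<and> T * k \<le> \<eta> * (2 * A) * x + C"
      using linear_dominates_dyadic_log[of "\<eta> * (2 * A)" T] T \<open>\<eta> > 0\<close> \<open>A > 0\<close> by auto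
    show "\<exists>C\<ge>0. \<forall>L L' l (f::real \<Rightarrow> 'a) g c t.
       geodesic L f \<longrightarrow> geodesic L' g \<longrightarrow> f 0 = g 0 \<longrightarrow> f L = c 0 \<longrightarrow> g L' = c l \<longrightarrow>
       1-lipschitz_on {0..l} c \<longrightarrow> 0 \<le> l \<longrightarrow> 0 \<le> t \<longrightarrow>
       (\<forall>s\<in>{0..l}. t + \<eta> * l + C \<le> dist (f 0) (c s)) \<longrightarrow> dist (f t) (g t) \<le> A"
    proof (intro exI[of _ "C + T"] conjI allI impI)
      show "0 \<le> C + T" using C T by simp
      fix L L' l t and f g c :: "real \<Rightarrow> 'a"
      assume H: "geodesic L f" "geodesic L' g" "f 0 = g 0" "f L = c 0" "g L' = c l"
        "1-lipschitz_on {0..l} c" "0 \<le> l" "0 \<le> t"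
        and far: "\<forall>s\<in>{0..l}. t + \<eta> * l + (C + T) \<le> dist (f 0) (c s)"
      obtain k :: nat where k: "l / (2 * A) \<le> 2 ^ k" "T * k \<le> \<eta> * (2 * A) * (l / (2 * A)) + C"
        using C(2)[of "l / (2 * A)"] H \<open>A > 0\<close> by auto
      have k1: "l - 0 \<le> 2 * A * 2 ^ k" using k(1) \<open>A > 0\<close> by (simp add: field_simps)
      have k2: "T * k \<le> \<eta> * l + C" using k(2) \<open>A > 0\<close> by simp
      have "t + T * (k + 1) \<le> dist (f 0) (c s)" if "s \<in> {0..l}" for s
        using far[rule_format, OF that] k2 by (simp add: algebra_simps)
      with T(2,1) H(1-7) k1 H(8) show "dist (f t) (g t) \<le> A"
        by (rule dyadic_contraction[where A = A and T = T and k = k and c = c and a = 0 and b = l])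
    qed
  qed
qed

text \<open>Follow the path from \<open>f L\<close> until it first reaches the ball of radius
  \<open>R\<close> around \<open>f 0\<close>. Up to then it is far enough out for contraction, so a
  geodesic from \<open>f 0\<close> to the entry point passes \<open>A\<close>-close to
  \<open>f t\<close>, and the entry point is only \<open>R - t\<close> further along.\<close>

lemma geodesic_near_path:
  assumes "\<eta> > 0"
  shows "\<exists>C\<ge>0. \<forall>L (f::real \<Rightarrow> 'a) t l Q. geodesic L f \<longrightarrow> 0 \<le> t \<longrightarrow> t \<le> L \<longrightarrow>
     lip_path l (f L) (f 0) Q \<longrightarrow> (\<exists>w\<in>Q. dist (f t) w \<le> \<eta> * l + C)"
proof -
  obtain A where A: "A > 0" "\<forall>\<eta>>0. \<exists>C\<ge>0. \<forall>L L' l (f::real \<Rightarrow> 'a) g c t.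
     geodesic L f \<longrightarrow> geodesic L' g \<longrightarrow> f 0 = g 0 \<longrightarrow> f L = c 0 \<longrightarrow> g L' = c l \<longrightarrow>
     1-lipschitz_on {0..l} c \<longrightarrow> 0 \<le> l \<longrightarrow> 0 \<le> t \<longrightarrow>
     (\<forall>s\<in>{0..l}. t + \<eta> * l + C \<le> dist (f 0) (c s)) \<longrightarrow> dist (f t) (g t) \<le> A"
    using contraction_along_path by blast
  obtain C where C: "C \<ge> 0" "\<And>L L' l (f::real \<Rightarrow> 'a) g c t.
     \<lbrakk>geodesic L f; geodesic L' g; f 0 = g 0; f L = c 0; g L' = c l;
     1-lipschitz_on {0..l} c; 0 \<le> l; 0 \<le> t;
     \<And>s. s\<in>{0..l} \<Longrightarrow> t + \<eta> * l + C \<le> dist (f 0) (c s)\<rbrakk> \<Longrightarrow> dist (f t) (g t) \<le> A"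
    using A(2)[rule_format, OF assms] by metis
  show ?thesis
  proof (intro exI[of _ "C + A"] conjI allI impI)
    show "0 \<le> C + A" using A C by simp
    fix L t l Q and f :: "real \<Rightarrow> 'a"
    assume f: "geodesic L f" and t: "0 \<le> t" "t \<le> L" and "lip_path l (f L) (f 0) Q"
    then obtain c where c: "1-lipschitz_on {0..l} c" "c 0 = f L" "c l = f 0" "0 \<le> l" "c ` {0..l} = Q"
      by (auto simp: lip_path_def)
    define R where "R = t + \<eta> * l + C"
    have "0 \<le> \<eta> * l" using assms c by simp
    then have R0: "0 \<le> R" "t \<le> R" using t C by (auto simp: R_def)
    show "\<exists>w\<in>Q. dist (f t) w \<le> \<eta> * l + (C + A)"
    proof (cases "L \<le> R")
      case True
      have "dist (f t) (f L) = L - t" using geodesic_dist[OF f, of t L] t by auto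
      moreover have "f L \<in> Q" using c by (auto intro: image_eqI[of _ _ 0])
      ultimately show ?thesis using True A by (intro bexI[of _ "f L"]) (auto simp: R_def)
    next
      case False
      have fL: "dist (f 0) (f L) = L" using geodesic_dist[OF f, of 0 L] t by auto
      have cont: "continuous_on {0..l} (\<lambda>s. dist (f 0) (c s))"
        by (intro continuous_intros lipschitz_on_continuous_on[OF c(1)])
      define S where "S = {s \<in> {0..l}. dist (f 0) (c s) \<le> R}"
      have "closed S" unfolding S_def
        using continuous_closed_preimage[OF cont, of "{..R}"] by (simp add: vimage_def Int_def conj_commute)
      moreover have "S \<subseteq> {0..l}" by (auto simp: S_def)
      ultimately have "compact S" using compact_Int_closed[of "{0..l}" S] by (simp add: inf_absorb2)
      moreover have "l \<in> S" using c R0 by (simp add: S_def)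
      ultimately obtain s where s: "s \<in> S" "\<And>r. r \<in> S \<Longrightarrow> s \<le> r"
        using compact_attains_inf[of S] by auto
      have sl: "0 \<le> s" "s \<le> l" "dist (f 0) (c s) \<le> R" using s by (auto simp: S_def)
      have before: "R \<le> dist (f 0) (c r)" if "0 \<le> r" "r < s" for r
      proof (rule ccontr)
        assume "\<not> R \<le> dist (f 0) (c r)"
        then have "r \<in> S" using that sl by (simp add: S_def)
        then show False using s(2)[of r] that by simp
      qed
      \<comment> \<open>If the path were strictly inside the ball at the first time of
        \<open>S\<close>, it would have met the sphere earlier.\<close>
      have at: "R \<le> dist (f 0) (c s)"
      proof (rule ccontr)
        assume *: "\<not> R \<le> dist (f 0) (c s)"
        have "\<exists>r\<ge>0. r \<le> s \<and> dist (f 0) (c r) = R"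
          by (rule IVT2'[of "\<lambda>s. dist (f 0) (c s)" s R 0])
            (use * False fL c sl in \<open>auto intro: continuous_on_subset[OF cont]\<close>)
        then obtain r where "0 \<le> r" "r \<le> s" "dist (f 0) (c r) = R" by blast
        then show False using * s(2)[of r] sl by (auto simp: S_def)
      qed
      have far: "t + \<eta> * s + C \<le> dist (f 0) (c r)" if "r \<in> {0..s}" for r
      proof -
        have "\<eta> * s \<le> \<eta> * l" using sl assms by (intro mult_left_mono) auto
        then show ?thesis using before[of r] at that by (cases "r = s") (auto simp: R_def)
      qed
      let ?e = "dist (f 0) (c s)"
      obtain g where g: "geodesic ?e g" "g 0 = f 0" "g ?e = c s" by (rule geodesic_between)
      have "dist (f t) (g t) \<le> A"
        by (rule C(2)[OF f g(1), of c s])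
          (use g c sl t far in \<open>auto intro: lipschitz_on_subset\<close>)
      moreover have "dist (g t) (c s) = R - t"
        using geodesic_dist[OF g(1), of t ?e] g at sl R0 t by auto
      ultimately have "dist (f t) (c s) \<le> A + (R - t)"
        using dist_triangle[of "f t" "c s" "g t"] by simp
      moreover have "c s \<in> Q" using c sl by auto
      ultimately show ?thesis by (intro bexI[of _ "c s"]) (auto simp: R_def)
    qed
  qed
qed

section \<open>Short detours near two sides and thin triangles\<close>

text \<open>The detour runs back along \<open>f\<close> to a parameter \<open>t\<close> where the
  legs are \<open>A\<close>-close, crosses there, and runs forward along \<open>g\<close>. It
  therefore never strays more than \<open>A\<close> from the legs.\<close>

lemma connect_legs:
  "\<exists>A>0. \<exists>C\<ge>0. \<forall>L L' (f::real \<Rightarrow> 'a) g a b h. geodesic L f \<longrightarrow> geodesic L' g \<longrightarrow> f 0 = g 0 \<longrightarrow>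
     a \<in> {0..L} \<longrightarrow> b \<in> {0..L'} \<longrightarrow> dist (f a) (g b) \<le> 6 * h \<longrightarrow>
     (\<exists>l Q. lip_path l (f a) (g b) Q \<and> l \<le> 30 * h + C \<and>
       (\<forall>w\<in>Q. \<exists>p \<in> f ` {0..L} \<union> g ` {0..L'}. dist p w \<le> A))"
proof -
  obtain A where A: "A > 0" "\<forall>\<eta>>0. \<exists>C\<ge>0. \<forall>L L' l (f::real \<Rightarrow> 'a) g c t.
     geodesic L f \<longrightarrow> geodesic L' g \<longrightarrow> f 0 = g 0 \<longrightarrow> f L = c 0 \<longrightarrow> g L' = c l \<longrightarrow>
     1-lipschitz_on {0..l} c \<longrightarrow> 0 \<le> l \<longrightarrow> 0 \<le> t \<longrightarrow>
     (\<forall>s\<in>{0..l}. t + \<eta> * l + C \<le> dist (f 0) (c s)) \<longrightarrow> dist (f t) (g t) \<le> A"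
    using contraction_along_path by blast
  obtain C where C: "C \<ge> 0" "\<And>L L' l (f::real \<Rightarrow> 'a) g c t.
     \<lbrakk>geodesic L f; geodesic L' g; f 0 = g 0; f L = c 0; g L' = c l;
     1-lipschitz_on {0..l} c; 0 \<le> l; 0 \<le> t;
     \<And>s. s\<in>{0..l} \<Longrightarrow> t + 1 * l + C \<le> dist (f 0) (c s)\<rbrakk> \<Longrightarrow> dist (f t) (g t) \<le> A"
    using A(2)[rule_format, OF zero_less_one] by metis
  show ?thesis
  proof (rule exI[of _ A], rule conjI[OF A(1)], rule exI[of _ "2 * C + A"], intro conjI allI impI)
    show "0 \<le> 2 * C + A" using A C by simp
    fix L L' a b h and f g :: "real \<Rightarrow> 'a"
    assume f: "geodesic L f" and g: "geodesic L' g" and 0: "f 0 = g 0"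
      and a: "a \<in> {0..L}" and b: "b \<in> {0..L'}" and h: "dist (f a) (g b) \<le> 6 * h"
    have h0: "0 \<le> h" using h zero_le_dist[of "f a" "g b"] by linarith
    have fa: "geodesic a f" and gb: "geodesic b g"
      using geodesic_prefix[OF f] geodesic_prefix[OF g] a b by auto
    have d: "dist (f 0) (f a) = a" "dist (g 0) (g b) = b"
      using geodesic_dist[OF f, of 0 a] geodesic_dist[OF g, of 0 b] a b by auto
    have ab: "\<bar>a - b\<bar> \<le> 6 * h"
      using d 0 h abs_dist_diff_le[of "f a" "f 0" "g b"] by (simp add: dist_commute)
    \<comment> \<open>The geodesic from \<open>f a\<close> to \<open>g b\<close> has length at most
      \<open>6 * h\<close> and may come \<open>6 * h\<close> nearer to the origin; contraction with
      slope 1 asks for \<open>6 * h + C\<close> more. If this passes the origin,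
      \<open>t = 0\<close> and the legs meet.\<close>
    define t where "t = max 0 (a - (12 * h + C))"
    have t: "0 \<le> t" "t \<le> a" "t \<le> b" "a - t \<le> 12 * h + C" "b - t \<le> 18 * h + C"
      using a b h0 C(1) ab by (auto simp: t_def)
    let ?d = "dist (f a) (g b)"
    have fgt: "dist (f t) (g t) \<le> A"
    proof (cases "t = 0")
      case True
      then show ?thesis using 0 A by simp
    next
      case False
      then have te: "t = a - (12 * h + C)" by (auto simp: t_def max_def split: if_splits)
      obtain c where c: "geodesic ?d c" "c 0 = f a" "c ?d = g b" by (rule geodesic_between)
      have far: "t + 1 * ?d + C \<le> dist (f 0) (c s)" if "s \<in> {0..?d}" for s
        using geodesic_dist[OF c(1), of 0 s] that c h te d
          dist_triangle[of "f 0" "f a" "c s"] by (simp add: dist_commute)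
      show ?thesis
        by (rule C(2)[OF fa gb, of c ?d]) (use 0 c far t geodesic_lipschitz in auto)
    qed
    let ?e = "dist (f t) (g t)"
    obtain k where k: "geodesic ?e k" "k 0 = f t" "k ?e = g t" by (rule geodesic_between)
    have p1: "lip_path (a - t) (f a) (f t) (f ` {t..a})"
      by (rule lip_path_rev[OF geodesic_segment_lip_path[OF f]]) (use t a in auto)
    have p2: "lip_path ?e (f t) (g t) (k ` {0..?e})"
      using geodesic_lip_path[OF k(1)] k by simp
    have p3: "lip_path (b - t) (g t) (g b) (g ` {t..b})"
      by (rule geodesic_segment_lip_path[OF g]) (use t b in auto)
    have "\<exists>p \<in> f ` {0..L} \<union> g ` {0..L'}. dist p w \<le> A"
      if "w \<in> f ` {t..a} \<union> (k ` {0..?e} \<union> g ` {t..b})" for w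
    proof (cases "w \<in> k ` {0..?e}")
      case True
      then obtain s where s: "0 \<le> s" "s \<le> ?e" "w = k s" by auto
      then have "dist (f t) w \<le> A" using geodesic_dist[OF k(1), of 0 s] k fgt by auto
      then show ?thesis using t a by (intro bexI[of _ "f t"]) auto
    next
      case False
      then have "w \<in> f ` {0..L} \<union> g ` {0..L'}" using that t a b by force
      then show ?thesis using A by (intro bexI[of _ w]) auto
    qed
    then show "\<exists>l Q. lip_path l (f a) (g b) Q \<and> l \<le> 30 * h + (2 * C + A) \<and>
       (\<forall>w\<in>Q. \<exists>p \<in> f ` {0..L} \<union> g ` {0..L'}. dist p w \<le> A)"
      using lip_path_join[OF p1 lip_path_join[OF p2 p3]] t fgt h0 C(1)
      by (intro exI[of _ "(a - t) + (?e + (b - t))"]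
          exI[of _ "f ` {t..a} \<union> (k ` {0..?e} \<union> g ` {t..b})"]) auto
  qed
qed

lemma connect_two_sides:
  "\<exists>A>0. \<exists>C\<ge>0. \<forall>L L' (f::real \<Rightarrow> 'a) g h u v. geodesic L f \<longrightarrow> geodesic L' g \<longrightarrow> f 0 = g 0 \<longrightarrow>
     u \<in> f ` {0..L} \<union> g ` {0..L'} \<longrightarrow> v \<in> f ` {0..L} \<union> g ` {0..L'} \<longrightarrow> dist u v \<le> 6 * h \<longrightarrow>
     (\<exists>l Q. lip_path l u v Q \<and> l \<le> 30 * h + C \<and>
       (\<forall>w\<in>Q. \<exists>p \<in> f ` {0..L} \<union> g ` {0..L'}. dist p w \<le> A))"
proof -
  obtain A C where A: "A > 0" and C: "C \<ge> 0" and conn: "\<And>L L' (f::real \<Rightarrow> 'a) g a b h.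
     \<lbrakk>geodesic L f; geodesic L' g; f 0 = g 0; a \<in> {0..L}; b \<in> {0..L'}; dist (f a) (g b) \<le> 6 * h\<rbrakk> \<Longrightarrow>
     \<exists>l Q. lip_path l (f a) (g b) Q \<and> l \<le> 30 * h + C \<and>
       (\<forall>w\<in>Q. \<exists>p \<in> f ` {0..L} \<union> g ` {0..L'}. dist p w \<le> A)"
    using connect_legs by metis
  have same_leg: "\<exists>l Q. lip_path l u v Q \<and> l \<le> 30 * h + C \<and> Q \<subseteq> f ` {0..L}"
    if f: "geodesic L f" and uv: "u \<in> f ` {0..L}" "v \<in> f ` {0..L}" and h: "dist u v \<le> 6 * h"
    for L f h and u v :: 'a
  proof -
    obtain a b where a: "a \<in> {0..L}" "u = f a" and b: "b \<in> {0..L}" "v = f b" using uv by blast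
    have "0 \<le> h" using h zero_le_dist[of u v] by linarith
    have ab: "\<bar>a - b\<bar> \<le> 6 * h" using geodesic_dist[OF f, of a b] a b h by auto
    have "lip_path \<bar>a - b\<bar> u v (f ` {min a b..max a b})"
    proof (cases "a \<le> b")
      case True
      then show ?thesis using geodesic_segment_lip_path[OF f, of a b] a b by (simp add: min_def max_def)
    next
      case False
      then show ?thesis
        using lip_path_rev[OF geodesic_segment_lip_path[OF f, of b a]] a b by (simp add: min_def max_def)
    qed
    moreover have "f ` {min a b..max a b} \<subseteq> f ` {0..L}" using a b by (intro image_mono) auto
    ultimately show ?thesis using ab \<open>0 \<le> h\<close> C by (intro exI conjI) auto
  qed
  show ?thesis
  proof (rule exI[of _ A], rule conjI[OF A], rule exI[of _ C], rule conjI[OF C], intro allI impI)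
    fix L L' h u v and f g :: "real \<Rightarrow> 'a"
    assume f: "geodesic L f" and g: "geodesic L' g" and 0: "f 0 = g 0"
      and u: "u \<in> f ` {0..L} \<union> g ` {0..L'}" and v: "v \<in> f ` {0..L} \<union> g ` {0..L'}"
      and h: "dist u v \<le> 6 * h"
    let ?P = "f ` {0..L} \<union> g ` {0..L'}"
    have near: "\<exists>p\<in>?P. dist p w \<le> A" if "w \<in> ?P" for w
      using that A by (intro bexI[of _ w]) auto
    consider "u \<in> f ` {0..L}" "v \<in> f ` {0..L}" | "u \<in> g ` {0..L'}" "v \<in> g ` {0..L'}"
      | "u \<in> f ` {0..L}" "v \<in> g ` {0..L'}" | "u \<in> g ` {0..L'}" "v \<in> f ` {0..L}"
      using u v by blast
    then show "\<exists>l Q. lip_path l u v Q \<and> l \<le> 30 * h + C \<and> (\<forall>w\<in>Q. \<exists>p\<in>?P. dist p w \<le> A)"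
    proof cases
      case 1
      then show ?thesis using same_leg[OF f 1 h] near by (meson UnI1 subsetD)
    next
      case 2
      then show ?thesis using same_leg[OF g 2 h] near by (meson UnI2 subsetD)
    next
      case 3
      then show ?thesis using conn[OF f g 0] h by blast
    next
      case 4
      have "dist v u \<le> 6 * h" using h by (simp add: dist_commute)
      then obtain l Q where "lip_path l v u Q" "l \<le> 30 * h + C" "\<forall>w\<in>Q. \<exists>p\<in>?P. dist p w \<le> A"
        using conn[OF f g 0] 4 by blast
      then show ?thesis using lip_path_rev by blast
    qed
  qed
qed

text \<open>Let \<open>m\<close> be the point of one side farthest from the other two, at distance \<open>h\<close>. The points of
  that side at distance \<open>2 * h\<close> from \<open>m\<close> are joined outside the ball of radius \<open>h - A\<close> around \<open>m\<close>
  by a path of length linear in \<open>h\<close>, so \<open>geodesic_near_path\<close> bounds \<open>h\<close>.\<close>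

lemma thin_side:
  "\<exists>\<delta>\<ge>0. \<forall>L1 L2 L3 (\<gamma>1::real \<Rightarrow> 'a) \<gamma>2 \<gamma>3. \<forall>p\<in>\<gamma>1 ` {0..L1}.
     geodesic L1 \<gamma>1 \<longrightarrow> geodesic L2 \<gamma>2 \<longrightarrow> geodesic L3 \<gamma>3 \<longrightarrow>
     \<gamma>1 L1 = \<gamma>2 0 \<longrightarrow> \<gamma>2 L2 = \<gamma>3 0 \<longrightarrow> \<gamma>3 L3 = \<gamma>1 0 \<longrightarrow>
     infdist p (\<gamma>2 ` {0..L2} \<union> \<gamma>3 ` {0..L3}) \<le> \<delta>"
proof -
  obtain A C where A: "A > 0" and C: "C \<ge> 0" and conn: "\<And>L L' (f::real \<Rightarrow> 'a) g h u v.
     \<lbrakk>geodesic L f; geodesic L' g; f 0 = g 0;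
     u \<in> f ` {0..L} \<union> g ` {0..L'}; v \<in> f ` {0..L} \<union> g ` {0..L'}; dist u v \<le> 6 * h\<rbrakk> \<Longrightarrow>
     \<exists>l Q. lip_path l u v Q \<and> l \<le> 30 * h + C \<and>
       (\<forall>w\<in>Q. \<exists>p \<in> f ` {0..L} \<union> g ` {0..L'}. dist p w \<le> A)"
    using connect_two_sides by metis
  obtain B where B: "B \<ge> 0" "\<And>L (f::real \<Rightarrow> 'a) t l Q. \<lbrakk>geodesic L f; 0 \<le> t; t \<le> L;
     lip_path l (f L) (f 0) Q\<rbrakk> \<Longrightarrow> \<exists>w\<in>Q. dist (f t) w \<le> 1/64 * l + B"
    \<comment> \<open>The closed-up path below has length at most \<open>32 * h + C\<close>, so
      slope 1/64 contributes only \<open>h / 2\<close> and can be absorbed.\<close>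
    using geodesic_near_path[of "1/64"] by auto
  show ?thesis
  proof (intro exI[of _ "2 * (A + B + C)"] conjI allI ballI impI)
    show "0 \<le> 2 * (A + B + C)" using A B C by simp
    fix L1 L2 L3 p and \<gamma>1 \<gamma>2 \<gamma>3 :: "real \<Rightarrow> 'a"
    assume p: "p \<in> \<gamma>1 ` {0..L1}"
      and g1: "geodesic L1 \<gamma>1" and g2: "geodesic L2 \<gamma>2" and g3: "geodesic L3 \<gamma>3"
      and e12: "\<gamma>1 L1 = \<gamma>2 0" and e23: "\<gamma>2 L2 = \<gamma>3 0" and e31: "\<gamma>3 L3 = \<gamma>1 0"
    let ?P = "\<gamma>2 ` {0..L2} \<union> \<gamma>3 ` {0..L3}"
    have LL: "0 \<le> L1" "0 \<le> L2" "0 \<le> L3" using g1 g2 g3 by (auto simp: geodesic_def)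
    have cont: "continuous_on {0..L} \<gamma>" if "geodesic L \<gamma>" for L and \<gamma> :: "real \<Rightarrow> 'a"
      using lipschitz_on_continuous_on[OF geodesic_lipschitz[OF that]] .
    have cP: "compact ?P" using cont g2 g3 by (intro compact_Un compact_continuous_image) auto
    have neP: "?P \<noteq> {}" using LL by auto
    have "continuous_on {0..L1} (\<lambda>t. infdist (\<gamma>1 t) ?P)"
      by (intro continuous_intros cont g1)
    then obtain t where t: "t \<in> {0..L1}" and max: "\<And>s. s \<in> {0..L1} \<Longrightarrow> infdist (\<gamma>1 s) ?P \<le> infdist (\<gamma>1 t) ?P"
      using continuous_attains_sup[of "{0..L1}" "\<lambda>t. infdist (\<gamma>1 t) ?P"] LL by auto
    define h where "h = infdist (\<gamma>1 t) ?P"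
    have h0: "0 \<le> h" by (simp add: h_def infdist_nonneg)
    have hP: "h \<le> dist (\<gamma>1 t) w" if "w \<in> ?P" for w
      unfolding h_def using that by (rule infdist_le)
    \<comment> \<open>Shortest segments to the other sides have length at most \<open>h\<close> by
      maximality. Starting \<open>2 * h\<close> away from the farthest point, they stay at distance
      at least \<open>h\<close> from it; a start already on \<open>?P\<close> needs only the
      constant path.\<close>
    have escape: "\<exists>u'\<in>?P. dist (\<gamma>1 a) u' \<le> h \<and>
        (\<exists>Q. lip_path (dist (\<gamma>1 a) u') (\<gamma>1 a) u' Q \<and> (\<forall>w\<in>Q. h \<le> dist (\<gamma>1 t) w))"
      if a: "a \<in> {0..L1}" and alt: "\<gamma>1 a \<in> ?P \<or> \<bar>a - t\<bar> = 2 * h" for a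
    proof (cases "\<gamma>1 a \<in> ?P")
      case True
      have "1-lipschitz_on {0..0} (\<lambda>_. \<gamma>1 a)" by (auto intro: lipschitz_onI)
      then have "lip_path 0 (\<gamma>1 a) (\<gamma>1 a) {\<gamma>1 a}"
        by (auto simp: lip_path_def intro!: exI[of _ "\<lambda>_. \<gamma>1 a"])
      then show ?thesis using True hP h0 by (intro bexI[of _ "\<gamma>1 a"]) auto
    next
      case False
      have "continuous_on ?P (dist (\<gamma>1 a))" by (intro continuous_intros)
      then obtain u' where u': "u' \<in> ?P" "\<And>w. w \<in> ?P \<Longrightarrow> dist (\<gamma>1 a) u' \<le> dist (\<gamma>1 a) w"
        using continuous_attains_inf[OF cP neP] by (metis (no_types))
      have "dist (\<gamma>1 a) u' \<le> infdist (\<gamma>1 a) ?P"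
        unfolding infdist_notempty[OF neP] using u'(2) by (intro cINF_greatest[OF neP])
      then have le: "dist (\<gamma>1 a) u' \<le> h" using max[OF a] by (simp add: h_def)
      let ?d = "dist (\<gamma>1 a) u'"
      obtain k where k: "geodesic ?d k" "k 0 = \<gamma>1 a" "k ?d = u'" by (rule geodesic_between)
      have "h \<le> dist (\<gamma>1 t) w" if "w \<in> k ` {0..?d}" for w
      proof -
        from that obtain s where s: "0 \<le> s" "s \<le> ?d" "w = k s" by auto
        then have "dist (\<gamma>1 a) w \<le> h" using geodesic_dist[OF k(1), of 0 s] k le by auto
        moreover have "dist (\<gamma>1 a) (\<gamma>1 t) = 2 * h"
          using geodesic_dist[OF g1, of a t] a t alt False by auto
        ultimately show ?thesis using dist_triangle[of "\<gamma>1 a" "\<gamma>1 t" w] by (simp add: dist_commute)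
      qed
      then show ?thesis using u' le geodesic_lip_path[OF k(1)] k by auto
    qed
    \<comment> \<open>Truncation at an end of the side gives a vertex, which lies on
      \<open>?P\<close>, so \<open>escape\<close> applies in either case.\<close>
    define a b where "a = max 0 (t - 2 * h)" and "b = min L1 (t + 2 * h)"
    have ab: "a \<in> {0..L1}" "b \<in> {0..L1}" "a \<le> t" "t \<le> b" "b - a \<le> 4 * h"
      using t h0 by (auto simp: a_def b_def)
    have "\<gamma>3 L3 \<in> ?P" using LL by force
    then have "\<gamma>1 0 \<in> ?P" by (simp only: e31)
    then have "\<gamma>1 a \<in> ?P \<or> \<bar>a - t\<bar> = 2 * h"
      by (cases "t - 2 * h \<le> 0") (use h0 in \<open>auto simp: a_def max_def\<close>)
    then obtain u' Qu where u': "u' \<in> ?P" "dist (\<gamma>1 a) u' \<le> h"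
      and Qu: "lip_path (dist (\<gamma>1 a) u') (\<gamma>1 a) u' Qu" "\<And>w. w \<in> Qu \<Longrightarrow> h \<le> dist (\<gamma>1 t) w"
      using escape[OF ab(1)] by blast
    have "\<gamma>1 L1 \<in> ?P" using e12 LL by auto
    then have "\<gamma>1 b \<in> ?P \<or> \<bar>b - t\<bar> = 2 * h"
      by (cases "L1 \<le> t + 2 * h") (use h0 in \<open>auto simp: b_def min_def\<close>)
    then obtain v' Qv where v': "v' \<in> ?P" "dist (\<gamma>1 b) v' \<le> h"
      and Qv: "lip_path (dist (\<gamma>1 b) v') (\<gamma>1 b) v' Qv" "\<And>w. w \<in> Qv \<Longrightarrow> h \<le> dist (\<gamma>1 t) w"
      using escape[OF ab(2)] by blast
    have "dist (\<gamma>1 a) (\<gamma>1 b) \<le> 4 * h" using geodesic_dist[OF g1, of a b] ab by auto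
    then have "dist v' u' \<le> 6 * h"
      using u' v' dist_triangle[of v' u' "\<gamma>1 b"] dist_triangle[of "\<gamma>1 b" u' "\<gamma>1 a"]
      by (simp add: dist_commute)
    moreover have "(\<lambda>s. \<gamma>2 (L2 - s)) ` {0..L2} = \<gamma>2 ` {0..L2}"
      by (rule image_rev_interval)
    ultimately obtain l Q where Q: "lip_path l v' u' Q" "l \<le> 30 * h + C"
      "\<And>w. w \<in> Q \<Longrightarrow> \<exists>p\<in>?P. dist p w \<le> A"
      \<comment> \<open>Reversing the second side makes both legs start at their common
        vertex.\<close>
      using conn[OF geodesic_rev[OF g2] g3, of v' u' h] u' v' e23 by auto
    let ?l = "dist (\<gamma>1 b) v' + (l + dist (\<gamma>1 a) u')"
    have path: "lip_path ?l (\<gamma>1 b) (\<gamma>1 a) (Qv \<union> (Q \<union> Qu))"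
      by (rule lip_path_join[OF Qv(1) lip_path_join[OF Q(1) lip_path_rev[OF Qu(1)]]])
    have far: "h - A \<le> dist (\<gamma>1 t) w" if "w \<in> Qv \<union> (Q \<union> Qu)" for w
    proof (cases "w \<in> Q")
      case True
      then obtain q where "q \<in> ?P" "dist q w \<le> A" using Q(3) by blast
      then show ?thesis using hP[of q] dist_triangle[of "\<gamma>1 t" q w] by (simp add: dist_commute)
    next
      case False
      then show ?thesis using that Qu(2)[of w] Qv(2)[of w] A by auto
    qed
    obtain w where "w \<in> Qv \<union> (Q \<union> Qu)" "dist (\<gamma>1 (a + (t - a))) w \<le> 1/64 * ?l + B"
      using B(2)[OF geodesic_segment[OF g1, of a b], of "t - a" ?l] path ab by auto
    then have "64 * h \<le> 64 * A + 64 * B + ?l" using far[of w] by (simp add: field_simps)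
    moreover have "?l \<le> 32 * h + C" using Q(2) u' v' by simp
    ultimately have "32 * h \<le> 64 * A + 64 * B + C" by simp
    then have "h \<le> 2 * (A + B + C)" using A B(1) C by simp
    then show "infdist p ?P \<le> 2 * (A + B + C)" using p max by (force simp: h_def)
  qed
qed

end

theorem theorem5p1:
  assumes "geodesic_space TYPE('a::metric_space)"
    and "\<epsilon> > 0" and "\<rho> > 0"
    and "\<forall>L1 (\<gamma>1::real \<Rightarrow> 'a) L2 \<gamma>2. bigon \<rho> L1 \<gamma>1 L2 \<gamma>2 \<longrightarrow> bigon_thin \<epsilon> L1 \<gamma>1 L2 \<gamma>2"
  shows "hyperbolic TYPE('a)"
proof -
  interpret thin_bigon_space "TYPE('a)" \<epsilon> \<rho>
    using assms by unfold_locales auto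
  obtain \<delta> where "\<delta> \<ge> 0" and \<delta>: "\<And>L1 L2 L3 (\<gamma>1::real \<Rightarrow> 'a) \<gamma>2 \<gamma>3 p. \<lbrakk>p \<in> \<gamma>1 ` {0..L1};
     geodesic L1 \<gamma>1; geodesic L2 \<gamma>2; geodesic L3 \<gamma>3;
     \<gamma>1 L1 = \<gamma>2 0; \<gamma>2 L2 = \<gamma>3 0; \<gamma>3 L3 = \<gamma>1 0\<rbrakk> \<Longrightarrow>
     infdist p (\<gamma>2 ` {0..L2} \<union> \<gamma>3 ` {0..L3}) \<le> \<delta>"
    using thin_side by metis
  show ?thesis
    unfolding hyperbolic_def
  proof (intro exI[of _ \<delta>] conjI allI impI ballI)
    show "\<delta> \<ge> 0" by fact
  next
    fix L1 L2 L3 p and \<gamma>1 \<gamma>2 \<gamma>3 :: "real \<Rightarrow> 'a"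
    assume T: "geodesic L1 \<gamma>1 \<and> geodesic L2 \<gamma>2 \<and> geodesic L3 \<gamma>3 \<and>
      \<gamma>1 L1 = \<gamma>2 0 \<and> \<gamma>2 L2 = \<gamma>3 0 \<and> \<gamma>3 L3 = \<gamma>1 0"
    show "infdist p (\<gamma>2 ` {0..L2} \<union> \<gamma>3 ` {0..L3}) \<le> \<delta>" if "p \<in> \<gamma>1 ` {0..L1}"
      using \<delta>[OF that] T by blast
    \<comment> \<open>The other two sides follow by rotating the triangle; here the rotation swaps
      the two sets in the union.\<close>
    show "infdist p (\<gamma>1 ` {0..L1} \<union> \<gamma>3 ` {0..L3}) \<le> \<delta>" if "p \<in> \<gamma>2 ` {0..L2}"
      using \<delta>[OF that, of L3 \<gamma>3 L1 \<gamma>1] T by (simp add: Un_commute)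
    show "infdist p (\<gamma>1 ` {0..L1} \<union> \<gamma>2 ` {0..L2}) \<le> \<delta>" if "p \<in> \<gamma>3 ` {0..L3}"
      using \<delta>[OF that, of L1 \<gamma>1 L2 \<gamma>2] T by blast
  qed
qed

end
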